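(* There exist positive constants $c_1$, $c_2$ such that the following holds. Let $H$ be a Hadamard matrix of order $n\ge 4$ having a submatrix $M$ of order $m<n$ which is a maximal determinant matrix, i.e. $|\det(M)| = D(m)$. Then $m < n/2 + c_1\lambda(n)\ln n$ or $m \ge n - c_2\lambda(n)$.
   Context: A Hadamard matrix of order $n$ is an $n\times n$ matrix $H$ with entries in $\{+1,-1\}$ satisfying $HH^T = nI$. A submatrix of order $m$ is obtained by selecting any $m$ rows and any $m$ columns. For a positive integer $m$, $D(m)$ denotes the maximum of $|\det(A)|$ over all $m\times m$ matrices $A$ with entries in $\{+1,-1\}$. The prime gap function $\lambda(n)$ is the maximum of $p_{i+1}-p_i$ over all pairs of consecutive primes $p_i < p_{i+1}$ with $p_i \le n$. $\ln$ denotes the natural logarithm. (No assumption of the Hadamard conjecture is made.) *)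

theory Defs
  imports
    Complex_Main
    "HOL-Computational_Algebra.Primes"
    "Jordan_Normal_Form.Determinant"
    "Jordan_Normal_Form.DL_Submatrix"
begin

definition sign_mats :: "nat \<Rightarrow> real mat set" where
  "sign_mats m = {A \<in> carrier_mat m m. elements_mat A \<subseteq> {1, -1}}"

definition hadamard :: "nat \<Rightarrow> real mat \<Rightarrow> bool" where
  "hadamard n H \<longleftrightarrow>
     H \<in> sign_mats n \<and> H * transpose_mat H = smult_mat (real n) (one_mat n)"

lemma finite_sign_mats: "finite (sign_mats m)"
proof -
  let ?F = "PiE ({..<m} \<times> {..<m}) (\<lambda>_. {1, -1 :: real})"
  have "sign_mats m \<subseteq> (\<lambda>f. mat m m f) ` ?F"
  proof
    fix A assume A: "A \<in> sign_mats m"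
    let ?f = "restrict (\<lambda>ij. A $$ ij) ({..<m} \<times> {..<m})"
    have "A = mat m m ?f"
      using A by (intro eq_matI) (auto simp: sign_mats_def)
    moreover have "?f \<in> ?F"
    proof (rule restrict_PiE_iff[THEN iffD2], rule ballI)
      fix ij assume "ij \<in> {..<m} \<times> {..<m}"
      then have "A $$ ij \<in> elements_mat A"
        using A by (cases ij) (auto simp: sign_mats_def intro: elements_matI)
      then show "A $$ ij \<in> {1, -1}"
        using A by (auto simp: sign_mats_def)
    qed
    ultimately show "A \<in> (\<lambda>f. mat m m f) ` ?F" by blast
  qed
  then show ?thesis
    by (rule finite_subset) (intro finite_imageI finite_PiE, auto)
qed

lemma sign_mats_nonempty: "sign_mats m \<noteq> {}"
proof -
  have "mat m m (\<lambda>_. 1) \<in> sign_mats m"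
    by (auto simp: sign_mats_def elements_mat_def)
  then show ?thesis by blast
qed

definition max_det :: "nat \<Rightarrow> real" where
  "max_det m = Max ((\<lambda>A. \<bar>det A\<bar>) ` sign_mats m)"

definition maximal_determinant_matrix :: "nat \<Rightarrow> real mat \<Rightarrow> bool" where
  "maximal_determinant_matrix m M \<longleftrightarrow> M \<in> sign_mats m \<and> \<bar>det M\<bar> = max_det m"

definition consecutive_primes :: "nat \<Rightarrow> nat \<Rightarrow> bool" where
  "consecutive_primes p q \<longleftrightarrow>
     prime p \<and> prime q \<and> p < q \<and> \<not> (\<exists>r. prime r \<and> p < r \<and> r < q)"

text \<open>Only the smaller prime of the pair is bounded by \<open>n\<close>; the set of gaps is nonempty
  for \<open>n \<ge> 2\<close>.\<close>

definition prime_gap :: "nat \<Rightarrow> nat" where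
  "prime_gap n = Max {q - p | p q. consecutive_primes p q \<and> p \<le> n}"

lemma finite_prime_gaps: "finite {q - p | p q. consecutive_primes p q \<and> p \<le> n}"
proof -
  have uniq: "q = (THE q. consecutive_primes p q)" if "consecutive_primes p q" for p q
    using that unfolding consecutive_primes_def
    by (intro the_equality[symmetric]) (auto, metis linorder_neqE_nat)
  have "{q - p | p q. consecutive_primes p q \<and> p \<le> n}
          \<subseteq> (\<lambda>p. (THE q. consecutive_primes p q) - p) ` {..n}"
    using uniq by blast
  then show ?thesis by (rule finite_subset) auto
qed

end

theory Submission
  imports Defs "HOL-Number_Theory.Euler_Criterion" "HOL-Analysis.Convex"
begin

text \<open>
Let \<open>d = n - m\<close>. By Jacobi's identity for complementary minors and Hadamard's inequality,
\<open>D(m)\<^sup>2 \<le> n\<^bsup>2m-n\<^esup> d\<^sup>d\<close>. Conversely, the Paley construction gives a Hadamard matrix of order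
\<open>h = 2(q + 1) \<ge> m\<close> for the least possible prime \<open>q\<close>, so that \<open>h \<le> m + T\<close> with
\<open>T = 2\<lambda>(n)\<close>; averaging the squared minors of \<open>m\<close> of its rows yields
\<open>D(m)\<^sup>2 \<ge> h\<^sup>m / (h choose m)\<close>. Hence \<open>m ln(m/n) + d ln(n/d) \<le> T (1 + ln(2n/T))\<close>.
The left-hand side is at least a multiple of \<open>d ln(n/d)\<close> when \<open>d/n\<close> is small, which forces
\<open>d = O(T)\<close>, and by concavity at least a multiple of \<open>n/2 - d\<close> otherwise. Keeping the term
\<open>ln(2n/T)\<close> rather than \<open>ln n\<close> makes any bound on prime gaps unnecessary.
\<close>

subsection \<open>Legendre symbol sums\<close>

lemma QuadRes_cong: "[a = b] (mod p) \<Longrightarrow> QuadRes p a \<longleftrightarrow> QuadRes p b"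
  unfolding QuadRes_def by (meson cong_sym cong_trans)

lemma Legendre_cong: "[a = b] (mod p) \<Longrightarrow> Legendre a p = Legendre b p"
  unfolding Legendre_def using QuadRes_cong[of a b p] cong_sym[of a b p] cong_trans[of a b p 0] cong_trans[of b a p 0]
  by auto

lemma Legendre_mod: "Legendre (a mod p) p = Legendre a p"
  by (rule Legendre_cong) simp

lemma Legendre_cases: "Legendre a p \<in> {-1, 0, 1}"
  by (auto simp: Legendre_def)

lemma Legendre_eq_0_iff: "Legendre a p = 0 \<longleftrightarrow> p dvd a"
  by (auto simp: Legendre_def cong_0_iff)

lemma Legendre_power2: "\<not> p dvd a \<Longrightarrow> Legendre a p * Legendre a p = 1"
  by (auto simp: Legendre_def cong_0_iff)

context
  fixes p :: nat
  assumes p: "prime p" "2 < p"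
begin

text \<open>Euler's criterion gives the identity modulo \<open>p\<close>. Both sides lie in {-1, 0,
  1}, so they differ by at most 2 < \<open>p\<close> and must agree.\<close>

lemma Legendre_mult: "Legendre (a * b) (int p) = Legendre a p * Legendre b p"
proof -
  have "[Legendre (a * b) p = (a * b) ^ ((p - 1) div 2)] (mod int p)"
    using euler_criterion p by blast
  also have "(a * b) ^ ((p - 1) div 2) = a ^ ((p - 1) div 2) * b ^ ((p - 1) div 2)"
    by (rule power_mult_distrib)
  also have "[\<dots> = Legendre a p * Legendre b p] (mod int p)"
    using euler_criterion[OF p, of a] euler_criterion[OF p, of b] by (intro cong_mult) (auto intro: cong_sym)
  finally have "int p dvd Legendre (a * b) p - Legendre a p * Legendre b p"
    by (simp add: cong_iff_dvd_diff)
  moreover have "\<bar>Legendre (a * b) p - Legendre a p * Legendre b p\<bar> \<le> 2"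
    using Legendre_cases[of "a * b" p] Legendre_cases[of a p] Legendre_cases[of b p] by auto
  ultimately have "Legendre (a * b) p - Legendre a p * Legendre b p = 0"
    using p dvd_imp_le_int[of "Legendre (a * b) p - Legendre a p * Legendre b p" "int p"] by linarith
  then show ?thesis by simp
qed

lemma sum_mod_reindex_mult:
  fixes g :: "int \<Rightarrow> 'b :: comm_monoid_add"
  assumes b: "\<not> int p dvd b"
  shows "(\<Sum>x\<in>{0..<int p}. g (b * x mod int p)) = sum g {0..<int p}"
proof (rule sum.reindex_bij_betw)
  have "inj_on (\<lambda>x. b * x mod int p) {0..<int p}"
  proof (rule inj_onI)
    fix x y assume xy: "x \<in> {0..<int p}" "y \<in> {0..<int p}" "b * x mod int p = b * y mod int p"
    then have "[b * x = b * y] (mod int p)" by (simp add: cong_def)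
    then have "[x = y] (mod int p)"
      using b p prime_imp_coprime_int[of "int p" b] by (simp add: cong_mult_lcancel coprime_commute)
    then show "x = y" using xy by (simp add: cong_def)
  qed
  moreover have "(\<lambda>x. b * x mod int p) ` {0..<int p} \<subseteq> {0..<int p}" using p by auto
  ultimately show "bij_betw (\<lambda>x. b * x mod int p) {0..<int p} {0..<int p}"
    by (simp add: bij_betw_def endo_inj_surj)
qed

lemma sum_mod_reindex_affine:
  fixes g :: "int \<Rightarrow> 'b :: comm_monoid_add"
  assumes e: "e = 1 \<or> e = -1"
  shows "(\<Sum>x\<in>{0..<int p}. g ((a + e * x) mod int p)) = sum g {0..<int p}"
proof (rule sum.reindex_bij_betw)
  have "inj_on (\<lambda>x. (a + e * x) mod int p) {0..<int p}"
  proof (rule inj_onI)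
    fix x y assume xy: "x \<in> {0..<int p}" "y \<in> {0..<int p}" "(a + e * x) mod int p = (a + e * y) mod int p"
    then have "[a + e * x = a + e * y] (mod int p)" by (simp add: cong_def)
    then have "[e * x = e * y] (mod int p)" by (simp add: cong_add_lcancel)
    then have "[x = y] (mod int p)"
      using e by (auto simp: cong_minus_minus_iff)
    then show "x = y" using xy by (simp add: cong_def)
  qed
  moreover have "(\<lambda>x. (a + e * x) mod int p) ` {0..<int p} \<subseteq> {0..<int p}" using p by auto
  ultimately show "bij_betw (\<lambda>x. (a + e * x) mod int p) {0..<int p} {0..<int p}"
    by (simp add: bij_betw_def endo_inj_surj)
qed

text \<open>If every unit were a quadratic residue, squaring would be surjective on the finite set
  of residues, hence injective; but 1 and \<open>p - 1\<close> have the same square.\<close>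

lemma ex_Legendre_eq_minus_1: "\<exists>b. Legendre b (int p) = -1"
proof (rule ccontr)
  assume "\<not> ?thesis"
  then have qr: "QuadRes (int p) b" if "\<not> int p dvd b" for b
    using that by (metis Legendre_def cong_0_iff)
  have "{0..<int p} \<subseteq> (\<lambda>x. x ^ 2 mod int p) ` {0..<int p}"
  proof
    fix b assume b: "b \<in> {0..<int p}"
    show "b \<in> (\<lambda>x. x ^ 2 mod int p) ` {0..<int p}"
    proof (cases "b = 0")
      case True
      then show ?thesis using p by (intro image_eqI[of _ _ 0]) auto
    next
      case False
      then have "\<not> int p dvd b" using b zdvd_not_zless[of b "int p"] by auto
      then obtain y where "[y ^ 2 = b] (mod int p)" using qr by (auto simp: QuadRes_def)
      then have "b = (y mod int p) ^ 2 mod int p" using b by (simp add: cong_def power_mod)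
      then show ?thesis using p by auto
    qed
  qed
  then have "inj_on (\<lambda>x. x ^ 2 mod int p) {0..<int p}"
    by (intro finite_surj_inj) auto
  moreover have "(int p - 1) ^ 2 mod int p = 1 ^ 2 mod int p"
  proof -
    have "(int p - 1) ^ 2 = 1 ^ 2 + int p * (int p - 2)" by (simp add: power2_eq_square algebra_simps)
    then show ?thesis by (metis mod_mult_self2)
  qed
  ultimately have "int p - 1 = 1" using p by (elim inj_onD) auto
  then show False using p by simp
qed

text \<open>Multiplication by a nonresidue permutes the residues and flips every sign, so the sum
  equals its own negative.\<close>

lemma sum_Legendre: "(\<Sum>x\<in>{0..<int p}. Legendre x p) = 0"
proof -
  obtain b where b: "Legendre b p = -1" using ex_Legendre_eq_minus_1 by blast
  then have "\<not> int p dvd b" using Legendre_eq_0_iff[of b p] by auto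
  then have "(\<Sum>x\<in>{0..<int p}. Legendre x p) = (\<Sum>x\<in>{0..<int p}. Legendre (b * x mod int p) p)"
    using sum_mod_reindex_mult[of b "\<lambda>x. Legendre x p"] by simp
  also have "\<dots> = - (\<Sum>x\<in>{0..<int p}. Legendre x p)"
    by (simp add: Legendre_mod Legendre_mult b sum_negf)
  finally show ?thesis by simp
qed

lemma sum_Legendre_affine:
  assumes "e = 1 \<or> e = -1"
  shows "(\<Sum>x\<in>{0..<int p}. Legendre (a + e * x) p) = 0"
  using sum_mod_reindex_affine[OF assms, of "\<lambda>x. Legendre x p" a] sum_Legendre
  by (simp add: Legendre_mod)

lemma sum_Legendre_square: "(\<Sum>x\<in>{0..<int p}. Legendre x p * Legendre x p) = int p - 1"
proof -
  have "(\<Sum>x\<in>{0..<int p}. Legendre x p * Legendre x p) = (\<Sum>x\<in>{0..<int p}. if x = 0 then 0 else 1)"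
  proof (rule sum.cong)
    fix x assume x: "x \<in> {0..<int p}"
    show "Legendre x p * Legendre x p = (if x = 0 then 0 else 1)"
    proof (cases "x = 0")
      case False
      then have "\<not> int p dvd x" using x zdvd_not_zless[of x "int p"] by auto
      then show ?thesis using Legendre_power2 False by simp
    qed (simp add: Legendre_def)
  qed simp
  also have "\<dots> = (\<Sum>x\<in>{0..<int p} - {0}. 1)"
    by (intro sum.mono_neutral_cong_right) auto
  also have "\<dots> = int p - 1" using p by (simp add: of_nat_diff)
  finally show ?thesis .
qed

text \<open>The sum is invariant under scaling of the shift, and over all shifts it adds up to 0.\<close>

lemma sum_Legendre_shift:
  assumes a: "\<not> int p dvd a"
  shows "(\<Sum>x\<in>{0..<int p}. Legendre x p * Legendre (a + x) p) = -1"
proof -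
  define S where "S = (\<lambda>a. \<Sum>x\<in>{0..<int p}. Legendre x p * Legendre (a + x) p)"
  have S_eq: "S b = S 1" if b: "\<not> int p dvd b" for b
  proof -
    have "S b = (\<Sum>x\<in>{0..<int p}. Legendre (b * x mod int p) p * Legendre (b + b * x mod int p) p)"
      unfolding S_def using sum_mod_reindex_mult[OF b, of "\<lambda>x. Legendre x p * Legendre (b + x) p"] by simp
    also have "\<dots> = (\<Sum>x\<in>{0..<int p}. Legendre x p * Legendre (1 + x) p)"
    proof (rule sum.cong)
      fix x
      have "Legendre (b + b * x mod int p) p = Legendre (b * (1 + x)) p"
        by (rule Legendre_cong) (simp add: cong_def mod_simps algebra_simps)
      then have "Legendre (b * x mod int p) p * Legendre (b + b * x mod int p) p
          = (Legendre b p * Legendre b p) * (Legendre x p * Legendre (1 + x) p)"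
        by (simp add: Legendre_mod Legendre_mult)
      then show "Legendre (b * x mod int p) p * Legendre (b + b * x mod int p) p
          = Legendre x p * Legendre (1 + x) p"
        using Legendre_power2[OF b] by simp
    qed simp
    finally show ?thesis by (simp add: S_def)
  qed
  have "(\<Sum>b\<in>{0..<int p}. S b) = (\<Sum>x\<in>{0..<int p}. Legendre x p * (\<Sum>b\<in>{0..<int p}. Legendre (x + 1 * b) p))"
    unfolding S_def sum_distrib_left by (subst sum.swap) (simp add: add.commute)
  also have "\<dots> = 0" using sum_Legendre_affine[of 1] by simp
  finally have "0 = (\<Sum>b\<in>{0..<int p}. S b)" by simp
  also have "\<dots> = S 0 + (\<Sum>b\<in>{0..<int p} - {0}. S b)"
    using p by (subst sum.remove[of _ 0]) auto
  also have "(\<Sum>b\<in>{0..<int p} - {0}. S b) = (\<Sum>b\<in>{0..<int p} - {0}. S 1)"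
  proof (rule sum.cong)
    fix b assume "b \<in> {0..<int p} - {0}"
    then show "S b = S 1" using zdvd_not_zless[of b "int p"] by (intro S_eq) auto
  qed simp
  also have "\<dots> = (int p - 1) * S 1" using p by (simp add: of_nat_diff)
  also have "S 0 = int p - 1" using sum_Legendre_square by (simp add: S_def)
  finally have "0 = (int p - 1) + (int p - 1) * S 1" .
  then have "(int p - 1) * (S 1 + 1) = 0" by (metis add.commute mult.right_neutral distrib_left)
  then have "S 1 = -1" using p by auto
  then show ?thesis using S_eq[OF a] by (simp add: S_def)
qed

text \<open>Row orthogonality of the Jacobsthal matrix Q with entries
  \<open>Legendre (i - j) p\<close>, that is, Q Q^T = p I - J with J the all-ones matrix.
  Substituting x for i - x leads to the shifted sum with shift k - i.\<close>

lemma sum_Legendre_diff: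
  assumes ij: "i < p" "k < p"
  shows "(\<Sum>j<p. Legendre (int i - int j) p * Legendre (int k - int j) p) = (if i = k then int p - 1 else -1)"
proof -
  have "(\<Sum>j<p. Legendre (int i - int j) p * Legendre (int k - int j) p)
      = (\<Sum>x\<in>{0..<int p}. Legendre (int i - x) p * Legendre (int k - x) p)"
    by (rule sum.reindex_bij_witness[where i = nat and j = int]) auto
  also have "\<dots> = (\<Sum>x\<in>{0..<int p}. Legendre ((int i + (-1) * x) mod int p) p
      * Legendre (int k - int i + (int i + (-1) * x) mod int p) p)"
  proof (rule sum.cong)
    fix x
    have "Legendre (int k - int i + (int i + (-1) * x) mod int p) p = Legendre (int k - x) p"
      by (rule Legendre_cong) (simp add: cong_def mod_simps)
    then show "Legendre (int i - x) p * Legendre (int k - x) p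
      = Legendre ((int i + (-1) * x) mod int p) p * Legendre (int k - int i + (int i + (-1) * x) mod int p) p"
      by (simp add: Legendre_mod)
  qed simp
  also have "\<dots> = (\<Sum>x\<in>{0..<int p}. Legendre x p * Legendre (int k - int i + x) p)"
    by (rule sum_mod_reindex_affine[of "-1" "\<lambda>x. Legendre x p * Legendre (int k - int i + x) p"]) simp
  also have "\<dots> = (if i = k then int p - 1 else -1)"
  proof (cases "i = k")
    case True
    then show ?thesis using sum_Legendre_square by simp
  next
    case False
    have "\<not> int p dvd int k - int i"
      using ij False by (metis cong_iff_dvd_diff cong_int_iff cong_less_modulus_unique_nat)
    then show ?thesis using sum_Legendre_shift False by simp
  qed
  finally show ?thesis .
qed

lemma sum_Legendre_diff_single: "(\<Sum>j<p. Legendre (a - int j) p) = 0"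
proof -
  have "(\<Sum>j<p. Legendre (a - int j) p) = (\<Sum>x\<in>{0..<int p}. Legendre (a + (-1) * x) p)"
    by (rule sum.reindex_bij_witness[where i = nat and j = int]) auto
  then show ?thesis using sum_Legendre_affine[of "-1" a] by simp
qed

end

subsection \<open>Hadamard matrices of Paley type\<close>

lemma sign_mats_iff:
  "A \<in> sign_mats m \<longleftrightarrow> A \<in> carrier_mat m m \<and> (\<forall>i<m. \<forall>j<m. A $$ (i, j) = 1 \<or> A $$ (i, j) = -1)"
  unfolding sign_mats_def by (fastforce intro: elements_matI)

lemma sign_mats_mult_self:
  assumes "A \<in> sign_mats m" "i < m" "j < m"
  shows "A $$ (i, j) * A $$ (i, j) = 1"
  using assms unfolding sign_mats_iff by (metis mult_minus_left mult_minus_right mult_1 minus_minus)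

lemma hadamard_iff:
  "hadamard n H \<longleftrightarrow> H \<in> sign_mats n \<and>
     (\<forall>i<n. \<forall>k<n. (\<Sum>j<n. H $$ (i, j) * H $$ (k, j)) = (if i = k then real n else 0))"
proof (cases "H \<in> carrier_mat n n")
  case True
  have "H * transpose_mat H = smult_mat (real n) (one_mat n) \<longleftrightarrow>
    (\<forall>i<n. \<forall>k<n. (H * transpose_mat H) $$ (i, k) = smult_mat (real n) (one_mat n) $$ (i, k))"
    using True by (auto intro!: eq_matI simp del: index_mult_mat(1))
  also have "\<dots> \<longleftrightarrow> (\<forall>i<n. \<forall>k<n. (\<Sum>j<n. H $$ (i, j) * H $$ (k, j)) = (if i = k then real n else 0))"
    using True by (intro all_cong1 imp_cong refl) (auto simp: scalar_prod_def atLeast0LessThan)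
  finally show ?thesis by (simp add: hadamard_def)
qed (simp add: hadamard_def sign_mats_iff)

lemma sum_lessThan_add:
  "(\<Sum>j<a + b. f j) = (\<Sum>j<a. f j) + (\<Sum>j<b. f (a + j :: nat) :: 'a :: comm_monoid_add)"
  by (induction b) (simp_all add: add.assoc)

text \<open>The hypothesis makes the transpose divided by \<open>q\<close> a right inverse; for
  square matrices it is also a left inverse.\<close>

lemma orthogonal_columns_if_orthogonal_rows:
  fixes c :: "nat \<Rightarrow> nat \<Rightarrow> real"
  assumes q: "q \<noteq> 0"
    and orth: "\<And>i k. i < N \<Longrightarrow> k < N \<Longrightarrow> (\<Sum>j<N. c i j * c k j) = (if i = k then q else 0)"
    and ik: "i < N" "k < N"
  shows "(\<Sum>j<N. c j i * c j k) = (if i = k then q else 0)"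
proof -
  define A where "A = mat N N (\<lambda>(i, j). c i j)"
  define B where "B = mat N N (\<lambda>(i, j). c j i / q)"
  have AB: "A \<in> carrier_mat N N" "B \<in> carrier_mat N N" by (auto simp: A_def B_def)
  have "A * B = 1\<^sub>m N"
  proof (rule eq_matI)
    fix i k assume "i < dim_row (1\<^sub>m N :: real mat)" "k < dim_col (1\<^sub>m N :: real mat)"
    then have "i < N" "k < N" by auto
    then have "(A * B) $$ (i, k) = (\<Sum>j<N. c i j * c k j) / q"
      by (simp add: A_def B_def scalar_prod_def atLeast0LessThan sum_divide_distrib)
    then show "(A * B) $$ (i, k) = (1\<^sub>m N) $$ (i, k)"
      using orth[of i k] q \<open>i < N\<close> \<open>k < N\<close> by simp
  qed (auto simp: A_def B_def)
  then have "B * A = 1\<^sub>m N" using mat_mult_left_right_inverse AB by blast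
  then have "(B * A) $$ (i, k) = (1\<^sub>m N) $$ (i, k)" by simp
  moreover have "(B * A) $$ (i, k) = (\<Sum>j<N. c j i * c j k) / q"
    using ik by (simp add: A_def B_def scalar_prod_def atLeast0LessThan sum_divide_distrib)
  ultimately show ?thesis using ik q by (auto simp: field_simps split: if_splits)
qed

text \<open>With \<open>A = C + I\<close> and \<open>B = C - I\<close> the matrix with rows \<open>(A, B)\<close> and
  \<open>(-B\<^sup>T, A\<^sup>T)\<close> is a Hadamard matrix, because \<open>A\<close> and \<open>B\<close> commute.\<close>

lemma hadamard_of_conference:
  fixes c :: "nat \<Rightarrow> nat \<Rightarrow> real"
  assumes q: "q > 0" and N: "N = Suc q"
    and diag: "\<And>i. i < N \<Longrightarrow> c i i = 0"
    and off: "\<And>i j. i < N \<Longrightarrow> j < N \<Longrightarrow> i \<noteq> j \<Longrightarrow> c i j = 1 \<or> c i j = -1"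
    and orth: "\<And>i k. i < N \<Longrightarrow> k < N \<Longrightarrow> (\<Sum>j<N. c i j * c k j) = (if i = k then real q else 0)"
  shows "\<exists>H. hadamard (N + N) H"
proof
  define e where "e = (\<lambda>i j :: nat. if i = j then 1 else 0 :: real)"
  define h where "h = (\<lambda>i j. if i < N then if j < N then c i j + e i j else c i (j - N) - e i (j - N)
    else if j < N then e j (i - N) - c j (i - N) else c (j - N) (i - N) + e (j - N) (i - N))"
  have col: "(\<Sum>j<N. c j i * c j k) = (if i = k then real q else 0)" if "i < N" "k < N" for i k
    using orthogonal_columns_if_orthogonal_rows[of "real q" N c, OF _ orth that] q by simp
  have se: "(\<Sum>j<N. f j * e i j) = f i" "(\<Sum>j<N. e i j * f j) = f i"
    "(\<Sum>j<N. f j * e j i) = f i" "(\<Sum>j<N. e j i * f j) = f i" if "i < N" for f i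
    using that by (simp_all add: e_def if_distrib[of "(*) _"] if_distrib[of "\<lambda>x. x * _"] cong: if_cong)
  \<comment> \<open>In matrix terms, A A^T + B B^T = 2 C C^T + 2 I = 2 (q + 1) I, and
    \<open>N = q + 1\<close>. The block \<open>BR\<close> is the same computation with
    columns.\<close>
  have TL: "(\<Sum>j<N. (c i j + e i j) * (c k j + e k j)) + (\<Sum>j<N. (c i j - e i j) * (c k j - e k j))
      = (if i = k then real (N + N) else 0)" if "i < N" "k < N" for i k
  proof -
    have "(\<Sum>j<N. (c i j + e i j) * (c k j + e k j)) + (\<Sum>j<N. (c i j - e i j) * (c k j - e k j))
      = 2 * (\<Sum>j<N. c i j * c k j) + 2 * (\<Sum>j<N. e i j * e k j)"
      by (simp add: sum_distrib_left flip: sum.distrib) (simp add: algebra_simps)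
    also have "\<dots> = (if i = k then real (N + N) else 0)"
      by (simp only: orth[OF that] se(2)[OF that(1)]) (simp add: e_def N)
    finally show ?thesis .
  qed
  have BR: "(\<Sum>j<N. (e j i - c j i) * (e j k - c j k)) + (\<Sum>j<N. (c j i + e j i) * (c j k + e j k))
      = (if i = k then real (N + N) else 0)" if "i < N" "k < N" for i k
  proof -
    have "(\<Sum>j<N. (e j i - c j i) * (e j k - c j k)) + (\<Sum>j<N. (c j i + e j i) * (c j k + e j k))
      = 2 * (\<Sum>j<N. c j i * c j k) + 2 * (\<Sum>j<N. e j i * e j k)"
      by (simp add: sum_distrib_left flip: sum.distrib) (simp add: algebra_simps)
    also have "\<dots> = (if i = k then real (N + N) else 0)"
      by (simp only: col[OF that] se(4)[OF that(1)]) (simp add: e_def N)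
    finally show ?thesis .
  qed
  \<comment> \<open>No symmetry of C is used: what survives is 2 (C I - I C) = 0.\<close>
  have TR: "(\<Sum>j<N. (c i j + e i j) * (e j k - c j k)) + (\<Sum>j<N. (c i j - e i j) * (c j k + e j k)) = 0"
    if "i < N" "k < N" for i k
  proof -
    have "(\<Sum>j<N. (c i j + e i j) * (e j k - c j k)) + (\<Sum>j<N. (c i j - e i j) * (c j k + e j k))
      = 2 * (\<Sum>j<N. c i j * e j k) - 2 * (\<Sum>j<N. e i j * c j k)"
      by (simp add: sum_distrib_left flip: sum.distrib sum_subtractf) (simp add: algebra_simps)
    also have "\<dots> = 0" using that by (simp add: se)
    finally show ?thesis .
  qed
  have row: "(\<Sum>j<N + N. h i j * h k j) = (if i = k then real (N + N) else 0)"
    if ik: "i < N + N" "k < N + N" for i k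
  proof -
    consider "i < N" "k < N" | "i < N" "k \<ge> N" | "i \<ge> N" "k < N" | "i \<ge> N" "k \<ge> N" by linarith
    then show ?thesis
    proof cases
      case 1
      then show ?thesis using TL[of i k] by (simp add: sum_lessThan_add h_def)
    next
      case 2
      then show ?thesis using TR[of i "k - N"] ik by (simp add: sum_lessThan_add h_def)
    next
      case 3
      then show ?thesis using TR[of k "i - N"] ik by (simp add: sum_lessThan_add h_def mult.commute)
    next
      case 4
      then have "i = k \<longleftrightarrow> i - N = k - N" by auto
      then show ?thesis using BR[of "i - N" "k - N"] ik 4 by (simp add: sum_lessThan_add h_def)
    qed
  qed
  \<comment> \<open>The zero diagonal of C is exactly where adding or subtracting I supplies a
    sign.\<close>
  have ent: "h i j = 1 \<or> h i j = -1" if "i < N + N" "j < N + N" for i j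
  proof -
    have pm: "c a b + e a b = 1 \<or> c a b + e a b = -1" "c a b - e a b = 1 \<or> c a b - e a b = -1"
       if "a < N" "b < N" for a b
      using off[OF that] diag[OF that(1)] by (cases "a = b"; simp add: e_def)+
    have "i < N \<or> i - N < N" "j < N \<or> j - N < N" using that by auto
    then show ?thesis
      unfolding h_def using pm(1)[of i j] pm(2)[of i "j - N"] pm(2)[of j "i - N"] pm(1)[of "j - N" "i - N"]
      by (smt (verit))
  qed
  show "hadamard (N + N) (mat (N + N) (N + N) (\<lambda>(i, j). h i j))"
    unfolding hadamard_iff sign_mats_iff using row ent by simp
qed

text \<open>The conference matrix is the Jacobsthal matrix bordered by ones, with 0 in the corner.
  The border contributes J, which cancels the -J in Q Q^T, and the zero row sums of Q make the
  border row orthogonal to the others. Doubling the order covers all odd primes, whatever their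
  residue modulo 4.\<close>

lemma hadamard_Paley:
  assumes p: "prime p" "2 < p"
  shows "\<exists>H. hadamard (2 * (p + 1)) H"
proof -
  define c where "c = (\<lambda>i j. if i = 0 then if j = 0 then 0 else 1 else if j = 0 then 1
    else real_of_int (Legendre (int (i - 1) - int (j - 1)) p))"
  have "\<exists>H. hadamard (Suc p + Suc p) H"
  proof (rule hadamard_of_conference[where q = p and c = c])
    fix i assume "i < Suc p"
    show "c i i = 0" by (simp add: c_def Legendre_def)
  next
    fix i j assume ij: "i < Suc p" "j < Suc p" "i \<noteq> j"
    have "Legendre (int (i - 1) - int (j - 1)) p \<noteq> 0" if "i \<noteq> 0" "j \<noteq> 0"
    proof -
      have "i - 1 \<noteq> j - 1" "i - 1 < p" "j - 1 < p" using ij that by auto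
      then have "\<not> [int (i - 1) = int (j - 1)] (mod int p)"
        unfolding cong_int_iff using cong_less_modulus_unique_nat by blast
      then show ?thesis by (simp add: Legendre_eq_0_iff cong_iff_dvd_diff)
    qed
    then show "c i j = 1 \<or> c i j = -1"
      using Legendre_cases[of "int (i - 1) - int (j - 1)" p] ij by (auto simp: c_def)
  next
    have s1: "(\<Sum>j<p. real_of_int (Legendre (a - int j) p)) = 0" for a
      using sum_Legendre_diff_single[OF p, of a] by (simp flip: of_int_sum)
    have s2: "(\<Sum>j<p. real_of_int (Legendre (int i - int j) p) * real_of_int (Legendre (int k - int j) p))
       = (if i = k then real p - 1 else -1)" if "i < p" "k < p" for i k
      using arg_cong[OF sum_Legendre_diff[OF p that], of real_of_int] by simp
    fix i k assume ik: "i < Suc p" "k < Suc p"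
    show "(\<Sum>j<Suc p. c i j * c k j) = (if i = k then real p else 0)"
      unfolding sum.lessThan_Suc_shift
    proof (cases "i = 0 \<or> k = 0")
      case True
      then show "c i 0 * c k 0 + (\<Sum>j<p. c i (Suc j) * c k (Suc j)) = (if i = k then real p else 0)"
        using s1 by (auto simp: c_def)
    next
      case False
      then obtain i' k' where "i = Suc i'" "k = Suc k'" by (meson not0_implies_Suc)
      then show "c i 0 * c k 0 + (\<Sum>j<p. c i (Suc j) * c k (Suc j)) = (if i = k then real p else 0)"
        using s2[of i' k'] ik by (simp add: c_def)
    qed
  qed (use p in auto)
  then show ?thesis by (simp add: mult_2)
qed

subsection \<open>Minors of Hadamard matrices\<close>

text \<open>Hadamard's inequality in Gram form, by Gram-Schmidt from the last row: subtracting from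
  the other rows their projections onto it splits off the factor \<open>s\<close> and can only
  shorten them. Allowing \<open>n\<close> to differ from \<open>d\<close> keeps the induction in the
  same form.\<close>

lemma det_gram_le:
  fixes b :: "nat \<Rightarrow> nat \<Rightarrow> real"
  shows "det (mat d d (\<lambda>(i, k). \<Sum>j<n. b i j * b k j)) \<le> (\<Prod>i<d. \<Sum>j<n. b i j * b i j)"
proof (induction d arbitrary: b)
  case 0
  then show ?case by simp
next
  case (Suc d)
  define g where "g = (\<lambda>i k. \<Sum>j<n. b i j * b k j)"
  define s where "s = g d d"
  \<comment> \<open>If \<open>s = 0\<close>, division by zero gives \<open>u i = 0\<close>. This is
    harmless: row \<open>d\<close> then vanishes, so \<open>us\<close> still holds.\<close>
  define u where "u = (\<lambda>i. g i d / s)"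
  define b' where "b' = (\<lambda>i j. b i j - u i * b d j)"
  define g' where "g' = (\<lambda>i k. \<Sum>j<n. b' i j * b' k j)"
  have s_nonneg: "s \<ge> 0" by (simp add: s_def g_def sum_nonneg)
  have g_sym: "g i k = g k i" for i k by (simp add: g_def mult.commute)
  have us: "u i * s = g i d" for i
  proof (cases "s = 0")
    case True
    then have "b d j = 0" if "j < n" for j
      using that by (simp add: s_def g_def sum_nonneg_eq_0_iff)
    then show ?thesis using True by (simp add: g_def)
  qed (simp add: u_def)
  have g': "g' i k = g i k - u i * u k * s" for i k
  proof -
    have "g' i k = g i k - u k * g i d - u i * g d k + u i * u k * s"
      by (simp add: g'_def b'_def g_def s_def sum_distrib_left flip: sum.distrib sum_subtractf)
        (simp add: algebra_simps)
    also have "\<dots> = g i k - u i * u k * s" by (simp add: g_sym[of d k] flip: us)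
    finally show ?thesis .
  qed
  let ?G = "four_block_mat (mat d d (\<lambda>(i, k). g i k)) (mat d 1 (\<lambda>(i, k). g i d))
      (mat 1 d (\<lambda>(i, k). g d k)) (mat 1 1 (\<lambda>_. s))"
  \<comment> \<open>Column operations that clear the bottom row of \<open>?G\<close> and leave the
    Gram matrix of the projected rows as Schur complement.\<close>
  let ?F = "four_block_mat (1\<^sub>m d) (0\<^sub>m d 1) (mat 1 d (\<lambda>(i, k). - u k)) (1\<^sub>m 1)"
  have G: "mat (Suc d) (Suc d) (\<lambda>(i, k). g i k) = ?G"
    by (rule eq_matI) (auto simp: s_def less_Suc_eq)
  have dims: "?G \<in> carrier_mat (d + 1) (d + 1)" "?F \<in> carrier_mat (d + 1) (d + 1)" by auto
  have "?G * ?F = four_block_mat (mat d d (\<lambda>(i, k). g' i k)) (mat d 1 (\<lambda>(i, k). g i d))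
      (0\<^sub>m 1 d) (mat 1 1 (\<lambda>_. s))"
    apply (subst mult_four_block_mat[of _ d d _ 1 _ 1 _ _ d _ 1])
            apply (auto intro!: arg_cong2[where f = "\<lambda>x y. four_block_mat x _ y _"] cong_four_block_mat)
    subgoal by (rule eq_matI) (auto simp: scalar_prod_def g' us[symmetric])
    subgoal by (rule eq_matI) (auto simp: scalar_prod_def g_sym[of d] us[symmetric] mult.commute)
    done
  then have "det ?G * det ?F = det (mat d d (\<lambda>(i, k). g' i k)) * det (mat 1 1 (\<lambda>_. s))"
    using det_mult[OF dims] det_four_block_mat_lower_left_zero[of "mat d d (\<lambda>(i, k). g' i k)" d
      "mat d 1 (\<lambda>(i, k). g i d)" 1 "0\<^sub>m 1 d" "mat 1 1 (\<lambda>_. s)"] by simp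
  moreover have "det ?F = 1"
    by (subst det_four_block_mat_upper_right_zero[of _ d _ 1]) auto
  moreover have "det (mat 1 1 (\<lambda>_. s)) = s" by (subst det_single) auto
  ultimately have "det ?G = det (mat d d (\<lambda>(i, k). g' i k)) * s" by simp
  also have "\<dots> \<le> (\<Prod>i<d. g' i i) * s"
    using Suc.IH[of b'] s_nonneg by (intro mult_right_mono) (simp_all add: g'_def)
  also have "\<dots> \<le> (\<Prod>i<d. g i i) * s"
  proof (intro mult_right_mono prod_mono conjI)
    fix i
    show "0 \<le> g' i i" by (simp add: g'_def sum_nonneg)
    show "g' i i \<le> g i i" using s_nonneg by (simp add: g')
  qed (fact s_nonneg)
  finally show ?case using G by (simp add: g_def s_def)
qed

lemma det_power2_eq_gram:
  fixes A :: "'a :: comm_ring_1 mat"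
  assumes "A \<in> carrier_mat n n"
  shows "(det A)\<^sup>2 = det (mat n n (\<lambda>(i, k). \<Sum>j<n. A $$ (i, j) * A $$ (k, j)))"
proof -
  have "A * transpose_mat A = mat n n (\<lambda>(i, k). \<Sum>j<n. A $$ (i, j) * A $$ (k, j))"
    using assms by (intro eq_matI) (auto simp: scalar_prod_def atLeast0LessThan)
  then show ?thesis
    using det_mult[of A n "transpose_mat A"] det_transpose[OF assms] assms by (simp add: power2_eq_square)
qed

lemma det_sign_mat_le:
  assumes "A \<in> sign_mats d"
  shows "(det A)\<^sup>2 \<le> real d ^ d"
proof -
  have "(det A)\<^sup>2 \<le> (\<Prod>i<d. \<Sum>j<d. A $$ (i, j) * A $$ (i, j))"
    using assms det_gram_le[of d "\<lambda>i j. A $$ (i, j)" d] by (subst det_power2_eq_gram) (auto simp: sign_mats_iff)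
  also have "\<dots> = real d ^ d" using sign_mats_mult_self[OF assms] by simp
  finally show ?thesis .
qed

text \<open>Jacobi's identity, squared to remove signs. With H in blocks M, B, C, N, row
  orthogonality turns H times (M^T, 0; B^T, I) into (c I, B; 0, N). Taking determinants and using
  (det H)^2 = c^(m+d) gives the claim.\<close>

lemma det_complementary_minor:
  fixes h :: "nat \<Rightarrow> nat \<Rightarrow> real"
  assumes orth: "\<And>i k. i < m + d \<Longrightarrow> k < m + d \<Longrightarrow> (\<Sum>j<m + d. h i j * h k j) = (if i = k then c else 0)"
  shows "c ^ (m + d) * (det (mat m m (\<lambda>(i, j). h i j)))\<^sup>2
       = c ^ (2 * m) * (det (mat d d (\<lambda>(i, j). h (m + i) (m + j))))\<^sup>2"
proof -
  let ?M = "mat m m (\<lambda>(i, j). h i j)" and ?B = "mat m d (\<lambda>(i, j). h i (m + j))"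
    and ?C = "mat d m (\<lambda>(i, j). h (m + i) j)" and ?N = "mat d d (\<lambda>(i, j). h (m + i) (m + j))"
  let ?H = "four_block_mat ?M ?B ?C ?N"
  let ?F = "four_block_mat (transpose_mat ?M) (0\<^sub>m m d) (transpose_mat ?B) (1\<^sub>m d)"
  have dims: "?H \<in> carrier_mat (m + d) (m + d)" "?F \<in> carrier_mat (m + d) (m + d)" by auto
  have H: "?H = mat (m + d) (m + d) (\<lambda>(i, j). h i j)" by (rule eq_matI) auto
  have "?H * ?F = four_block_mat (c \<cdot>\<^sub>m 1\<^sub>m m) ?B (0\<^sub>m d m) ?N"
    apply (subst mult_four_block_mat[of _ m m _ d _ d _ _ m _ d])
            apply (auto intro!: cong_four_block_mat)
    subgoal using orth by (intro eq_matI) (auto simp: scalar_prod_def atLeast0LessThan sum_lessThan_add)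
    subgoal using orth[of "m + _" _] by (intro eq_matI) (auto simp: scalar_prod_def atLeast0LessThan sum_lessThan_add)
    done
  then have "det ?H * det ?F = det (c \<cdot>\<^sub>m 1\<^sub>m m :: real mat) * det ?N"
    using det_mult[OF dims] det_four_block_mat_lower_left_zero[of "c \<cdot>\<^sub>m 1\<^sub>m m" m ?B d "0\<^sub>m d m" ?N] by simp
  moreover have "det ?F = det ?M"
    by (subst det_four_block_mat_upper_right_zero[of _ m _ d]) (auto simp: det_transpose[of _ m])
  ultimately have "(det ?H)\<^sup>2 * (det ?M)\<^sup>2 = (c ^ m * det ?N)\<^sup>2"
    by (simp flip: power_mult_distrib)
  moreover have "(det ?H)\<^sup>2 = c ^ (m + d)"
  proof -
    let ?h = "mat (m + d) (m + d) (\<lambda>(i, j). h i j)"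
    have "mat (m + d) (m + d) (\<lambda>(i, k). \<Sum>j<m + d. ?h $$ (i, j) * ?h $$ (k, j)) = c \<cdot>\<^sub>m 1\<^sub>m (m + d)"
      using orth by (intro eq_matI) auto
    then show ?thesis unfolding H by (subst det_power2_eq_gram[of _ "m + d"]) auto
  qed
  ultimately show ?thesis by (simp add: power_mult_distrib power_mult[symmetric] mult.commute)
qed

text \<open>This permutation lists \<open>R\<close> first and its complement afterwards; it moves an
  arbitrary minor to the top left corner.\<close>

lemma bij_betw_pick_lessThan:
  assumes "R \<subseteq> {..<n}" "card R = m"
  shows "bij_betw (\<lambda>i. if i < m then pick R i else pick ({..<n} - R) (i - m)) {..<n} {..<n}"
proof -
  have fin: "finite R" using assms finite_subset by blast
  have m: "m \<le> n" using assms card_mono[of "{..<n}" R] by auto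
  have cc: "card ({..<n} - R) = n - m" using assms fin by (simp add: card_Diff_subset)
  have pick_bij: "bij_betw (pick S) {..<card S} S" if "finite S" for S
  proof -
    have "inj_on (pick S) {..<card S}"
      by (rule inj_onI) (metis lessThan_iff linorder_neqE_nat less_irrefl pick_mono_le)
    moreover have "pick S ` {..<card S} \<subseteq> S" using pick_in_set_le by auto
    ultimately show ?thesis
      using that by (simp add: bij_betw_def card_image card_subset_eq)
  qed
  have "bij_betw (\<lambda>i. if i \<in> {..<m} then pick R i else pick ({..<n} - R) (i - m))
      ({..<m} \<union> {m..<n}) (R \<union> ({..<n} - R))"
  proof (rule bij_betw_disjoint_Un)
    show "bij_betw (pick R) {..<m} R" using pick_bij[OF fin] assms by simp
    have "bij_betw (\<lambda>i. i - m) {m..<n} {..<n - m}"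
      by (rule bij_betwI[where g = "\<lambda>i. i + m"]) auto
    then show "bij_betw (\<lambda>i. pick ({..<n} - R) (i - m)) {m..<n} ({..<n} - R)"
      using bij_betw_trans[of "\<lambda>i. i - m" "{m..<n}" "{..<n - m}" "pick ({..<n} - R)" "{..<n} - R"]
        pick_bij[of "{..<n} - R"] cc by (simp add: comp_def)
  qed auto
  moreover have "{..<m} \<union> {m..<n} = {..<n}" "R \<union> ({..<n} - R) = {..<n}" using m assms by auto
  ultimately show ?thesis by simp
qed

text \<open>After permuting rows and columns, Jacobi's identity reduces the claim to Hadamard's
  bound for the complementary minor of order \<open>n - m\<close>. Nothing is divided by a power of
  \<open>n\<close>, so the exponent 2m - n, possibly negative, never appears.\<close>

lemma hadamard_minor_le:
  assumes H: "hadamard n H" and mn: "m \<le> n"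
    and R: "R \<subseteq> {..<n}" "card R = m" and C: "C \<subseteq> {..<n}" "card C = m"
  shows "real n ^ n * (det (submatrix H R C))\<^sup>2 \<le> real n ^ (2 * m) * real (n - m) ^ (n - m)"
proof -
  define a where "a = (\<lambda>i. if i < m then pick R i else pick ({..<n} - R) (i - m))"
  define b where "b = (\<lambda>i. if i < m then pick C i else pick ({..<n} - C) (i - m))"
  have ab: "bij_betw a {..<n} {..<n}" "bij_betw b {..<n} {..<n}"
    using bij_betw_pick_lessThan R C by (auto simp: a_def b_def)
  define h where "h = (\<lambda>i j. H $$ (a i, b j))"
  define d where "d = n - m"
  have n: "n = m + d" using mn by (simp add: d_def)
  have a_less: "a i < n" "b i < n" if "i < n" for i using ab that by (auto dest!: bij_betwE)
  have Hc: "H \<in> carrier_mat n n" using H by (auto simp: hadamard_def sign_mats_def)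
  have "(\<Sum>j<n. h i j * h k j) = (if i = k then real n else 0)" if "i < n" "k < n" for i k
  proof -
    have "(\<Sum>j<n. h i j * h k j) = (\<Sum>j<n. H $$ (a i, j) * H $$ (a k, j))"
      unfolding h_def by (rule sum.reindex_bij_betw[OF ab(2)])
    also have "\<dots> = (if a i = a k then real n else 0)"
      using H a_less that by (simp add: hadamard_iff)
    also have "a i = a k \<longleftrightarrow> i = k"
      using ab(1) that by (auto simp: bij_betw_def inj_on_def)
    finally show ?thesis .
  qed
  then have "real n ^ n * (det (mat m m (\<lambda>(i, j). h i j)))\<^sup>2
       = real n ^ (2 * m) * (det (mat d d (\<lambda>(i, j). h (m + i) (m + j))))\<^sup>2"
    unfolding n by (intro det_complementary_minor)
  also have "\<dots> \<le> real n ^ (2 * m) * real d ^ d"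
  proof (intro mult_left_mono det_sign_mat_le)
    show "mat d d (\<lambda>(i, j). h (m + i) (m + j)) \<in> sign_mats d"
      unfolding sign_mats_iff using H a_less n by (auto simp: h_def hadamard_iff sign_mats_iff)
  qed simp
  also have "mat m m (\<lambda>(i, j). h i j) = submatrix H R C"
  proof -
    have "{i. i < n \<and> i \<in> R} = R" "{j. j < n \<and> j \<in> C} = C" using R C by auto
    then show ?thesis using R C Hc
      by (intro eq_matI) (auto simp: submatrix_def h_def a_def b_def)
  qed
  finally show ?thesis by (simp add: d_def)
qed

section \<open>Lower bound for the maximal determinant by averaging\<close>

text \<open>Expanding both factors of each squared minor over permutations and summing over all column
  maps \<open>f\<close>, the orthogonality of the rows leaves only the diagonal terms.\<close>

lemma sum_det_minors_power2:
  fixes h :: "nat \<Rightarrow> nat \<Rightarrow> real"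
  assumes orth: "\<And>i k. i < m \<Longrightarrow> k < m \<Longrightarrow> (\<Sum>j<n. h i j * h k j) = (if i = k then c else 0)"
  shows "(\<Sum>f\<in>{0..<m} \<rightarrow>\<^sub>E {..<n}. (det (mat m m (\<lambda>(i, j). h j (f i))))\<^sup>2) = fact m * c ^ m"
proof -
  let ?P = "{p. p permutes {0..<m}}" and ?F = "{0..<m} \<rightarrow>\<^sub>E {..<n}"
  have finP: "finite ?P" by (rule finite_permutations) simp
  \<comment> \<open>Row \<open>i\<close> of the matrix holds the selected column \<open>f i\<close>,
    so the permutation acts on the rows of \<open>h\<close>. For fixed permutations the sum over
    \<open>f\<close> then factorises in \<open>diag\<close>.\<close>
  have det_eq: "det (mat m m (\<lambda>(i, j). h j (f i))) = (\<Sum>p\<in>?P. signof p * (\<Prod>i = 0..<m. h (p i) (f i)))" for f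
  proof -
    have "det (mat m m (\<lambda>(i, j). h j (f i)))
      = (\<Sum>p\<in>?P. signof p * (\<Prod>i = 0..<m. mat m m (\<lambda>(i, j). h j (f i)) $$ (i, p i)))"
      by (rule det_def') simp
    also have "\<dots> = (\<Sum>p\<in>?P. signof p * (\<Prod>i = 0..<m. h (p i) (f i)))"
    proof (intro sum.cong prod.cong refl arg_cong2[where f = "(*)"])
      fix p i assume "p \<in> ?P" "i \<in> {0..<m}"
      then have "p i < m" "i < m" using permutes_in_image[of p "{0..<m}" i] by auto
      then show "mat m m (\<lambda>(i, j). h j (f i)) $$ (i, p i) = h (p i) (f i)" by simp
    qed
    finally show ?thesis .
  qed
  have diag: "(\<Sum>f\<in>?F. \<Prod>i = 0..<m. h (p i) (f i) * h (r i) (f i)) = (if p = r then c ^ m else 0)"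
    if "p \<in> ?P" "r \<in> ?P" for p r
  proof -
    have less: "p i < m" "r i < m" if "i \<in> {0..<m}" for i
      using \<open>p \<in> ?P\<close> \<open>r \<in> ?P\<close> that permutes_in_image[of p "{0..<m}" i] permutes_in_image[of r "{0..<m}" i] by auto
    have "(\<Sum>f\<in>?F. \<Prod>i = 0..<m. h (p i) (f i) * h (r i) (f i))
      = (\<Prod>i = 0..<m. \<Sum>j<n. h (p i) j * h (r i) j)"
      by (rule prod_sum_PiE[symmetric]) auto
    also have "\<dots> = (\<Prod>i = 0..<m. if p i = r i then c else 0)"
      using less by (intro prod.cong) (auto simp: orth)
    also have "\<dots> = (if p = r then c ^ m else 0)"
    proof (cases "p = r")
      case False
      then obtain i where "p i \<noteq> r i" by blast
      moreover from this have "i \<in> {0..<m}"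
        using that by (metis mem_Collect_eq permutes_not_in)
      ultimately show ?thesis using False by (auto intro!: prod_zero)
    qed simp
    finally show ?thesis .
  qed
  have "(\<Sum>f\<in>?F. (det (mat m m (\<lambda>(i, j). h j (f i))))\<^sup>2)
    = (\<Sum>f\<in>?F. \<Sum>p\<in>?P. \<Sum>r\<in>?P. signof p * signof r * (\<Prod>i = 0..<m. h (p i) (f i) * h (r i) (f i)))"
    unfolding det_eq power2_eq_square sum_product prod.distrib by (simp add: mult_ac)
  also have "\<dots> = (\<Sum>p\<in>?P. \<Sum>r\<in>?P. signof p * signof r * (\<Sum>f\<in>?F. \<Prod>i = 0..<m. h (p i) (f i) * h (r i) (f i)))"
    unfolding sum_distrib_left by (subst sum.swap, rule sum.cong[OF refl], rule sum.swap)
  also have "\<dots> = (\<Sum>p\<in>?P. \<Sum>r\<in>?P. signof p * signof r * (if p = r then c ^ m else 0))"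
    by (intro sum.cong refl) (simp add: diag)
  also have "\<dots> = (\<Sum>p\<in>?P. c ^ m)"
    using finP by (intro sum.cong refl) (auto simp: if_distrib[of "(*) _"] sign_def cong: if_cong)
  also have "\<dots> = fact m * c ^ m" by (simp add: card_permutations[of "{0..<m}" m])
  finally show ?thesis .
qed

lemma max_det_ge: "A \<in> sign_mats m \<Longrightarrow> \<bar>det A\<bar> \<le> max_det m"
  unfolding max_det_def by (intro Max_ge finite_imageI finite_sign_mats imageI)

text \<open>A column map that is not injective repeats a row and contributes 0. Each of the m! (n
  choose m) injective ones contributes at most the square of \<open>max_det m\<close>.\<close>

lemma max_det_lower_bound:
  assumes H: "hadamard n H" and mn: "m \<le> n"
  shows "real n ^ m \<le> real (n choose m) * (max_det m)\<^sup>2"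
proof -
  let ?F = "{0..<m} \<rightarrow>\<^sub>E {..<n}"
  let ?A = "\<lambda>f. mat m m (\<lambda>(i, j). H $$ (j, f i))"
  let ?I = "{f \<in> ?F. inj_on f {0..<m}}"
  have "fact m * real n ^ m = (\<Sum>f\<in>?F. (det (?A f))\<^sup>2)"
    using H mn by (intro sum_det_minors_power2[symmetric]) (auto simp: hadamard_iff)
  also have "\<dots> = (\<Sum>f\<in>?I. (det (?A f))\<^sup>2)"
  proof (rule sum.mono_neutral_right)
    show "\<forall>f\<in>?F - ?I. (det (?A f))\<^sup>2 = 0"
    proof
      fix f assume "f \<in> ?F - ?I"
      then obtain i k where "i < m" "k < m" "i \<noteq> k" "f i = f k" by (auto simp: inj_on_def)
      then have "det (?A f) = 0"
        by (intro det_identical_rows[of _ m i k]) (auto intro!: eq_vecI)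
      then show "(det (?A f))\<^sup>2 = 0" by simp
    qed
  qed (auto intro: finite_PiE)
  also have "\<dots> \<le> (\<Sum>f\<in>?I. (max_det m)\<^sup>2)"
  proof (rule sum_mono)
    fix f assume "f \<in> ?I"
    then have "?A f \<in> sign_mats m"
      using H mn unfolding hadamard_iff sign_mats_iff by (auto simp: PiE_iff)
    then have "\<bar>det (?A f)\<bar>\<^sup>2 \<le> (max_det m)\<^sup>2"
      by (intro power_mono max_det_ge) auto
    then show "(det (?A f))\<^sup>2 \<le> (max_det m)\<^sup>2" by simp
  qed
  also have "\<dots> = real (card ?I) * (max_det m)\<^sup>2" by simp
  also have "real (card ?I) = fact m * real (n choose m)"
  proof -
    have "card ?I = (\<Prod>i = 0..<m. n - i)"
      using card_inj_on_subset_funcset[of "{0..<m}" "{..<n}" "{0..<m}"] by simp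
    also have "real \<dots> = (\<Prod>i = 0..<m. real n - real i)"
      using mn by (simp add: of_nat_diff)
    also have "\<dots> = fact m * real (n choose m)"
      by (simp add: binomial_gbinomial gbinomial_mult_fact)
    finally show ?thesis .
  qed
  finally show ?thesis by (simp add: mult.assoc)
qed

subsection \<open>The entropy inequality and the main result\<close>

text \<open>A Chernoff-type bound: (n choose k) x^k \<le> (1 + x)^n \<le> exp (n x) at x = T / n.
  Since x \<le> 1, the remaining k may be replaced by its upper bound T.\<close>

lemma ln_binomial_le:
  assumes "real k \<le> T" "T \<le> real n" "0 < T"
  shows "ln (real (n choose k)) \<le> T * (1 + ln (real n / T))"
proof -
  have kn: "k \<le> n" and n: "0 < n" using assms by auto
  define x where "x = T / n"
  have x: "0 < x" "x \<le> 1" using assms n by (auto simp: x_def)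
  have "real (n choose k) * x ^ k \<le> (\<Sum>i\<le>n. real (n choose i) * x ^ i * 1 ^ (n - i))"
    using member_le_sum[of k "{..n}" "\<lambda>i. real (n choose i) * x ^ i * 1 ^ (n - i)"] kn x by simp
  also have "\<dots> = (x + 1) ^ n" by (rule binomial_ring[symmetric])
  also have "\<dots> \<le> exp x ^ n" using exp_ge_add_one_self[of x] x by (intro power_mono) (auto simp: add.commute)
  also have "\<dots> = exp T" using n by (simp add: x_def flip: exp_of_nat_mult)
  finally have "ln (real (n choose k) * x ^ k) \<le> ln (exp T)"
    using kn x by (subst ln_le_cancel_iff) auto
  then have "ln (real (n choose k)) \<le> T + k * - ln x"
    using kn x by (simp add: ln_mult ln_realpow)
  also have "\<dots> \<le> T + T * - ln x"
    using assms x by (intro add_left_mono mult_right_mono) auto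
  also have "- ln x = ln (real n / T)" using assms n by (simp add: x_def ln_div)
  finally show ?thesis by (simp add: algebra_simps)
qed

lemma one_le_ln:
  fixes x :: real
  assumes "3 \<le> x"
  shows "1 \<le> ln x"
  using assms exp_le by (subst ln_ge_iff) auto

lemma two_le_ln:
  fixes x :: real
  assumes "9 \<le> x"
  shows "2 \<le> ln x"
proof -
  have "exp 2 = exp 1 * exp (1 :: real)" by (simp flip: exp_add)
  also have "\<dots> \<le> 3 * 3" by (intro mult_mono exp_le) auto
  finally show ?thesis using assms by (subst ln_ge_iff) auto
qed

text \<open>The first summand is at least -y, because -ln (1 - y) \<le> y / (1 - y). As ln 9 \<ge>
  2, this loss is at most half of y ln (1/y); hence the threshold 1/9.\<close>

lemma entropy_difference_ge_left:
  fixes y :: real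
  assumes "0 < y" "y \<le> 1 / 9"
  shows "y * ln (1 / y) / 2 \<le> (1 - y) * ln (1 - y) - y * ln y"
proof -
  have "ln (1 / (1 - y)) \<le> 1 / (1 - y) - 1" using assms by (intro ln_le_minus_one) auto
  then have "- ln (1 - y) * (1 - y) \<le> (1 / (1 - y) - 1) * (1 - y)"
    using assms by (intro mult_right_mono) (auto simp: ln_div)
  also have "\<dots> = y" using assms by (simp add: field_simps)
  finally have 1: "- y \<le> (1 - y) * ln (1 - y)" by (simp add: algebra_simps)
  have "2 \<le> ln (1 / y)" using assms by (intro two_le_ln) (auto simp: field_simps)
  then have "y * 2 \<le> y * ln (1 / y)" using assms by (intro mult_left_mono) auto
  then show ?thesis using 1 assms by (simp add: ln_div)
qed

text \<open>The negated function \<open>f\<close> is convex here, so it lies below its chord. The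
  end values are at most -1/9 and equal to 0, over an interval of length 7/18, which gives the slope
  2/7.\<close>

lemma entropy_difference_ge_right:
  fixes y :: real
  assumes "1 / 9 \<le> y" "y \<le> 1 / 2"
  shows "2 / 7 * (1 / 2 - y) \<le> (1 - y) * ln (1 - y) - y * ln y"
proof -
  define f where "f = (\<lambda>y :: real. y * ln y - (1 - y) * ln (1 - y))"
  have "convex_on {1 / 9..1 / 2} f"
  proof (rule f''_ge0_imp_convex)
    fix x :: real assume x: "x \<in> {1 / 9..1 / 2}"
    show "(f has_real_derivative (ln x + ln (1 - x) + 2)) (at x)"
      unfolding f_def using x by (auto intro!: derivative_eq_intros simp: field_simps)
    show "((\<lambda>x. ln x + ln (1 - x) + 2) has_real_derivative (1 / x - 1 / (1 - x))) (at x)"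
      using x by (auto intro!: derivative_eq_intros simp: field_simps)
    show "0 \<le> 1 / x - 1 / (1 - x)" using x by (simp add: field_simps)
  qed (rule convex_real_interval)
  define t where "t = (y - 1 / 9) * 18 / 7"
  have y: "y = (1 - t) * (1 / 9) + t * (1 / 2)" by (simp add: t_def field_simps)
  have t: "0 \<le> t" "t \<le> 1" using assms by (auto simp: t_def)
  have "f y \<le> (1 - t) * f (1 / 9) + t * f (1 / 2)"
    using convex_onD[OF \<open>convex_on _ f\<close> t, of "1 / 9" "1 / 2"] by (simp add: y)
  also have "f (1 / 2) = 0" by (simp add: f_def)
  also have "f (1 / 9) \<le> - 1 / 9"
    using entropy_difference_ge_left[of "1 / 9"] two_le_ln[of 9] by (simp add: f_def)
  finally have "f y \<le> (1 - t) * (- 1 / 9) + t * 0" using t by (simp add: mult_left_mono)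
  also have "\<dots> = - (2 / 7 * (1 / 2 - y))" by (simp add: t_def field_simps)
  finally show ?thesis unfolding f_def by linarith
qed

lemma deficit_bound_imp:
  fixes n d T :: real
  assumes d: "0 < d" "d < n / 2" and T: "2 \<le> T" and n: "4 \<le> n"
    and le: "(n - d) * ln ((n - d) / n) + d * ln (n / d) \<le> T * (1 + ln (2 * n / T))"
  shows "n / 2 - d \<le> 7 * T * ln n \<or> d \<le> 8 * T"
proof -
  define y where "y = d / n"
  have y: "0 < y" "y \<le> 1 / 2" using d by (auto simp: y_def field_simps)
  have "n * ((1 - y) * ln (1 - y) - y * ln y) = (n - d) * ln ((n - d) / n) + d * ln (n / d)"
    using d n by (simp add: y_def field_simps ln_div)
  then have phi: "n * ((1 - y) * ln (1 - y) - y * ln y) \<le> T * (1 + ln (2 * n / T))" using le by simp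
  show ?thesis
  proof (cases "1 / 9 \<le> y")
    case True
    have "n / 2 - d = 7 / 2 * (n * (2 / 7 * (1 / 2 - y)))" using n by (simp add: y_def field_simps)
    also have "\<dots> \<le> 7 / 2 * (n * ((1 - y) * ln (1 - y) - y * ln y))"
      using entropy_difference_ge_right[OF True y(2)] n by (intro mult_left_mono) auto
    also have "\<dots> \<le> 7 / 2 * (T * (1 + ln (2 * n / T)))" using phi by simp
    also have "\<dots> \<le> 7 / 2 * (T * (ln n + ln n))"
    proof (intro mult_left_mono add_mono)
      \<comment> \<open>This is where T \<ge> 2 enters.\<close>
      show "ln (2 * n / T) \<le> ln n" using n T by (subst ln_le_cancel_iff) (auto simp: field_simps)
      show "1 \<le> ln n" using n by (intro one_le_ln) simp
    qed (use T in auto)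
    finally show ?thesis by simp
  next
    case False
    have "d \<le> 8 * T"
    proof (rule ccontr)
      assume "\<not> d \<le> 8 * T"
      \<comment> \<open>Since 2n/T = 2 (n/d) k, the logarithm splits as ln 2 + w + ln k, and
        dividing by T removes n except through w. With w \<ge> 2, ln 2 \<le> 1 and ln k \<le> k/2,
        the result is k - 2 \<le> 2 + k/2, that is, k \<le> 8.\<close>
      define k where "k = d / T"
      define w where "w = ln (n / d)"
      have k: "8 < k" using \<open>\<not> d \<le> 8 * T\<close> T by (simp add: k_def field_simps)
      have w: "2 \<le> w"
        unfolding w_def using False d n by (intro two_le_ln) (auto simp: y_def field_simps)
      have "d * w / 2 = n * (y * ln (1 / y) / 2)" using n by (simp add: y_def w_def)
      also have "\<dots> \<le> n * ((1 - y) * ln (1 - y) - y * ln y)"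
        using entropy_difference_ge_left[of y] y False n by (intro mult_left_mono) auto
      also have "\<dots> \<le> T * (1 + ln (2 * n / T))" by (fact phi)
      also have "2 * n / T = 2 * (n / d) * k" using d by (simp add: k_def)
      also have "ln \<dots> = ln 2 + w + ln k"
        using d n k by (simp add: w_def ln_mult ln_div)
      finally have "T * (k * w / 2) \<le> T * (1 + (ln 2 + w + ln k))" using T by (simp add: k_def)
      then have "k * w / 2 \<le> 1 + (ln 2 + w + ln k)" using T by simp
      moreover have "ln 2 \<le> (1 :: real)" using ln_le_minus_one[of "2 :: real"] by simp
      moreover have "ln k \<le> k / 2"
        using ln_le_minus_one[of "k / 2"] k \<open>ln 2 \<le> 1\<close> by (simp add: ln_div)
      moreover have "2 * (k / 2 - 1) \<le> w * (k / 2 - 1)" using w k by (intro mult_right_mono) auto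
      ultimately show False using k by (simp add: algebra_simps)
    qed
    then show ?thesis ..
  qed
qed

section \<open>Prime gaps and the orders of Paley matrices\<close>

lemma prime_gap_ge: "consecutive_primes p q \<Longrightarrow> p \<le> n \<Longrightarrow> q - p \<le> prime_gap n"
  unfolding prime_gap_def by (intro Max_ge finite_prime_gaps) blast

lemma prime_gap_pos:
  assumes "2 \<le> n"
  shows "0 < prime_gap n"
proof -
  have "consecutive_primes 2 3" by (auto simp: consecutive_primes_def)
  then show ?thesis using prime_gap_ge[of 2 3 n] assms by simp
qed

text \<open>The least prime \<open>q\<close> whose Paley order reaches \<open>m\<close> and the
  largest prime \<open>p\<close> whose order stays below \<open>m\<close> are consecutive, so the
  order overshoots by at most twice a gap. The bound 7 \<le> m makes 2 a candidate for
  \<open>p\<close> and forces \<open>q\<close> to be odd.\<close>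

lemma ex_hadamard_above:
  assumes m: "7 \<le> m" "m \<le> n"
  shows "\<exists>h H. hadamard h H \<and> m \<le> h \<and> h \<le> m + 2 * prime_gap n"
proof -
  define q where "q = (LEAST q. prime q \<and> m \<le> 2 * (q + 1))"
  define p where "p = Max {p. prime p \<and> 2 * (p + 1) < m}"
  obtain r where "prime r" "m < r" using bigger_prime by blast
  then have q: "prime q" "m \<le> 2 * (q + 1)"
    using LeastI[of "\<lambda>q. prime q \<and> m \<le> 2 * (q + 1)" r] by (auto simp: q_def)
  have q_min: "2 * (r + 1) < m" if "prime r" "r < q" for r
    using not_less_Least[of r "\<lambda>q. prime q \<and> m \<le> 2 * (q + 1)"] that by (auto simp: q_def)
  have fin: "finite {p. prime p \<and> 2 * (p + 1) < m}" by (rule finite_subset[of _ "{..m}"]) auto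
  moreover have "2 \<in> {p. prime p \<and> 2 * (p + 1) < m}" using m by simp
  ultimately have p: "prime p" "2 * (p + 1) < m"
    using Max_in[of "{p. prime p \<and> 2 * (p + 1) < m}"] unfolding p_def by blast+
  have p_max: "r \<le> p" if "prime r" "2 * (r + 1) < m" for r
    unfolding p_def using fin that by (intro Max_ge) auto
  have "consecutive_primes p q"
    unfolding consecutive_primes_def
  proof (intro conjI notI)
    show "p < q" using less_le_trans[OF p(2) q(2)] by simp
    assume "\<exists>r. prime r \<and> p < r \<and> r < q"
    then obtain r where "prime r" "p < r" "r < q" by blast
    then show False using q_min[of r] p_max[of r] by simp
  qed (fact p q)+
  then have "q - p \<le> prime_gap n" using p m by (intro prime_gap_ge) auto
  then have "2 * (q + 1) \<le> m + 2 * prime_gap n" using p by simp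
  moreover have "2 < q" using q(2) m(1) by presburger
  ultimately show ?thesis using hadamard_Paley[OF q(1)] q(2) by blast
qed

text \<open>Logarithms of the upper and lower bounds for the same maximal determinant are compared,
  with h^m weakened to m^m.\<close>

lemma maximal_minor_deficit:
  assumes n: "hadamard n H" "0 < m" "m < n"
    and RC: "R \<subseteq> {..<n}" "card R = m" "C \<subseteq> {..<n}" "card C = m"
    and max: "maximal_determinant_matrix m (submatrix H R C)"
    and h: "hadamard h H'" "m \<le> h" "real h \<le> real m + T" and T: "0 < T" "T \<le> real m"
  shows "real m * ln (real m / real n) + real (n - m) * ln (real n / real (n - m))
    \<le> T * (1 + ln (2 * real n / T))"
proof -
  define d where "d = n - m"
  have d: "0 < d" "real n = real m + real d" using n by (auto simp: d_def)
  have mn: "real m < real n" using n by simp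
  have "real n ^ n * real h ^ m \<le> real n ^ n * (real (h choose m) * (max_det m)\<^sup>2)"
    using max_det_lower_bound[OF h(1,2)] by (intro mult_left_mono) auto
  also have "(max_det m)\<^sup>2 = (det (submatrix H R C))\<^sup>2"
    using max by (metis maximal_determinant_matrix_def power2_abs)
  also have "real n ^ n * (real (h choose m) * (det (submatrix H R C))\<^sup>2)
    = real (h choose m) * (real n ^ n * (det (submatrix H R C))\<^sup>2)" by simp
  also have "\<dots> \<le> real (h choose m) * (real n ^ (2 * m) * real d ^ d)"
    using hadamard_minor_le[OF n(1) _ RC] n by (intro mult_left_mono) (auto simp: d_def)
  finally have "ln (real n ^ n * real h ^ m) \<le> ln (real (h choose m) * (real n ^ (2 * m) * real d ^ d))"
    using n h d by (subst ln_le_cancel_iff) auto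
  then have "real n * ln n + real m * ln h \<le> ln (h choose m) + (2 * real m * ln n + real d * ln d)"
    using n h d by (simp add: ln_mult ln_realpow)
  moreover have "real m * ln m \<le> real m * ln h" using n h by (intro mult_left_mono) auto
  moreover have "ln (h choose m) \<le> T * (1 + ln (2 * real n / T))"
  proof -
    \<comment> \<open>The complementary index \<open>h - m\<close> is at most T, which makes the
      binomial small.\<close>
    have "ln (h choose m) = ln (h choose (h - m))" using binomial_symmetric[OF h(2)] by simp
    also have "\<dots> \<le> T * (1 + ln (real h / T))"
      using h T by (intro ln_binomial_le) auto
    also have "\<dots> \<le> T * (1 + ln (2 * real n / T))"
      \<comment> \<open>Here h \<le> m + T \<le> 2m < 2n.\<close>
      using h T mn n by (intro mult_left_mono add_left_mono, subst ln_le_cancel_iff)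
        (auto simp: divide_right_mono)
    finally show ?thesis .
  qed
  moreover have "real m * ln (real m / real n) + real d * ln (real n / real d)
      = real m * ln m + (real d - real m) * ln n - real d * ln d"
    using n d by (simp add: ln_div algebra_simps)
  moreover have "real n * ln n = real m * ln n + real d * ln n" using d by (simp add: distrib_right)
  ultimately show ?thesis by (simp add: d_def algebra_simps)
qed

theorem theorem5:
  shows "\<exists>c1 c2 :: real. c1 > 0 \<and> c2 > 0 \<and>
    (\<forall>(n::nat) (m::nat) (H :: real mat) (R :: nat set) (C :: nat set).
       n \<ge> 4 \<longrightarrow> hadamard n H \<longrightarrow> 0 < m \<longrightarrow> m < n \<longrightarrow>
       R \<subseteq> {..<n} \<longrightarrow> card R = m \<longrightarrow> C \<subseteq> {..<n} \<longrightarrow> card C = m \<longrightarrow>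
       maximal_determinant_matrix m (submatrix H R C) \<longrightarrow>
       real m < real n / 2 + c1 * real (prime_gap n) * ln (real n) \<or>
       real m \<ge> real n - c2 * real (prime_gap n))"
proof -
  \<comment> \<open>With T = 2L the deficit bounds 7T and 8T become 14L and 16L; 15 replaces 14 to
    make the first inequality strict.\<close>
  have "real m < real n / 2 + 15 * real (prime_gap n) * ln (real n) \<or> real m \<ge> real n - 16 * real (prime_gap n)"
    if n: "n \<ge> 4" and H: "hadamard n H" and m: "0 < m" "m < n"
      and RC: "R \<subseteq> {..<n}" "card R = m" "C \<subseteq> {..<n}" "card C = m"
      and max: "maximal_determinant_matrix m (submatrix H R C)" for n m H R C
  proof -
    define L where "L = real (prime_gap n)"
    have L: "1 \<le> L" using prime_gap_pos[of n] n by (simp add: L_def)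
    have ln_n: "1 \<le> ln n" using n by (intro one_le_ln) simp
    have Lln: "L * 1 \<le> L * ln n" using L ln_n by (intro mult_left_mono) auto
    \<comment> \<open>The first case gives the first alternative. In the second and third, n < 2m is
      less than 16L, so the second alternative is trivial. The last provides what the Paley order (7
      \<le> m) and the binomial bound (T \<le> m) require.\<close>
    consider "real m \<le> real n / 2" | "n < 2 * m" "m < 7" | "n < 2 * m" "m < 2 * L"
      | "real n / 2 < real m" "7 \<le> m" "2 * L \<le> m" by linarith
    then have "real m < real n / 2 + 15 * (L * ln n) \<or> real m \<ge> real n - 16 * L"
    proof cases
      case 4
      obtain h H' where h: "hadamard h H'" "m \<le> h" "h \<le> m + 2 * prime_gap n"
        using ex_hadamard_above[of m n] 4 m by auto
      then have "real h \<le> real m + 2 * L" unfolding L_def by linarith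
      note maximal_minor_deficit[OF H m RC max h(1,2) this _ 4(3)]
      moreover have "real (n - m) = real n - real m" using m by simp
      ultimately have "real n / 2 - (real n - real m) \<le> 7 * (2 * L) * ln n \<or> real n - real m \<le> 8 * (2 * L)"
        using L n m 4 by (intro deficit_bound_imp) auto
      moreover have "14 * L * ln n < 15 * (L * ln n)" using Lln L by simp
      ultimately show ?thesis by linarith
    qed (use Lln L m in linarith)+
    then show ?thesis by (simp add: L_def mult.assoc)
  qed
  then show ?thesis by - (rule exI[of _ 15], rule exI[of _ 16], simp)
qed

end
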